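(* Let $\rho>0$, let $H$ be regularly varying at $0$ with index $-\rho$, let $A,B$ be nonnegative random variables, suppose that $B$ is an $\mathrm{IED}^\rho_H(\gamma)$-random variable and that $A$ and $B$ are positively quadrant dependent. Let $a=\mathrm{ess\,inf}(A)=\sup\{x\in\mathbb{R}:\mathbb{P}(A<x)=0\}$, let $g$ be the $(\rho,H)$-local dependence measure of $(A,B)$, and let $$\phi_\rho(\lambda)=\inf_{y>0}\left\{g(y)+\frac{\lambda}{y^\rho}\right\}\ (\lambda\ge0),\qquad \lambda^\ast=\inf_{y>1}\left\{\frac{y^\rho}{y^\rho-1}g(y)\right\}.$$ Then for all $\lambda\ge 0$ $$\phi_\rho(\lambda)=\left(\gamma^{\frac1{1+\rho}}+a^{\frac{\rho}{1+\rho}}\lambda^{\frac1{1+\rho}}\right)^{1+\rho},$$ and $$\lambda^\ast=\begin{cases}\gamma\left(1-a^{\frac{\rho}{1+\rho}}\right)^{-(1+\rho)}, & a<1,\\ \infty, & a\ge1.\end{cases}$$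
   Context: A function $H:(0,\infty)\to(0,\infty)$ is regularly varying at $0$ with index $-\rho$ if $\lim_{x\to0^+}H(tx)/H(x)=t^{-\rho}$ for all $t>0$; by convention every such $H$ is taken continuous and nonincreasing. A nonnegative random variable $X$ is an $\mathrm{IED}^\rho_H(\gamma)$-random variable, where $\gamma\in[0,\infty]$, if $\lim_{x\to 0^+}\frac{-\log \mathbb{P}(X<x)}{H(x)}=\gamma$. A function $g:[0,\infty)\to[0,\infty]$ is the $(\rho,H)$-local dependence measure of a pair $(A,B)$ of nonnegative random variables if for every $y\ge 0$ the following limit exists and $$g(y)=\lim_{\varepsilon\to0^+}\frac{-\log\mathbb{P}(\varepsilon Ay+B<\varepsilon)}{H(\varepsilon)}.$$ Convention: $-\log 0=\infty$. In the present situation $g$ exists and equals $g(y)=\gamma(1-ay)^{-\rho}$ for $y\in[0,1/a)$ and $g(y)=\infty$ for $y\ge1/a$ (with $1/a=\infty$ if $a=0$). Random variables $A$ and $B$ are positively quadrant dependent if $\mathbb{P}(A>s,B>t)\ge\mathbb{P}(A>s)\mathbb{P}(B>t)$ for all $s,t\in\mathbb{R}$. *)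

theory Defs
  imports "HOL-Probability.Probability"
begin

definition regularly_varying_at_0 :: "real \<Rightarrow> (real \<Rightarrow> real) \<Rightarrow> bool" where
  "regularly_varying_at_0 \<rho> H \<longleftrightarrow>
     (\<forall>x>0. H x > 0) \<and> continuous_on {0<..} H \<and> antimono_on {0<..} H \<and>
     (\<forall>t>0. ((\<lambda>x. H (t * x) / H x) \<longlongrightarrow> t powr (- \<rho>)) (at_right 0))"

text \<open>\<open>- log p\<close> for a probability \<open>p\<close>. The case \<open>p = 0\<close> is explicit because \<^term>\<open>ln 0 = (0::real)\<close>
  in HOL; on the other hand \<^const>\<open>ennreal\<close> cuts off nothing as long as \<open>p \<le> 1\<close>.\<close>

definition neg_log :: "real \<Rightarrow> ennreal" where
  "neg_log p = (if p = 0 then \<infinity> else ennreal (- ln p))"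

definition IED :: "'a measure \<Rightarrow> (real \<Rightarrow> real) \<Rightarrow> ennreal \<Rightarrow> ('a \<Rightarrow> real) \<Rightarrow> bool" where
  "IED M H \<gamma> X \<longleftrightarrow>
     ((\<lambda>x. neg_log \<P>(\<omega> in M. X \<omega> < x) / ennreal (H x)) \<longlongrightarrow> \<gamma>) (at_right 0)"

text \<open>A function on \<open>[0,\<infinity>)\<close> is represented by a total function whose values at negative
  arguments are irrelevant.\<close>

definition local_dependence_measure ::
  "'a measure \<Rightarrow> (real \<Rightarrow> real) \<Rightarrow> ('a \<Rightarrow> real) \<Rightarrow> ('a \<Rightarrow> real) \<Rightarrow> (real \<Rightarrow> ennreal) \<Rightarrow> bool" where
  "local_dependence_measure M H A B g \<longleftrightarrow>
     (\<forall>y\<ge>0. ((\<lambda>\<epsilon>. neg_log \<P>(\<omega> in M. \<epsilon> * A \<omega> * y + B \<omega> < \<epsilon>) / ennreal (H \<epsilon>))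
               \<longlongrightarrow> g y) (at_right 0))"

definition positively_quadrant_dependent ::
  "'a measure \<Rightarrow> ('a \<Rightarrow> real) \<Rightarrow> ('a \<Rightarrow> real) \<Rightarrow> bool" where
  "positively_quadrant_dependent M A B \<longleftrightarrow>
     (\<forall>s t. \<P>(\<omega> in M. A \<omega> > s \<and> B \<omega> > t) \<ge> \<P>(\<omega> in M. A \<omega> > s) * \<P>(\<omega> in M. B \<omega> > t))"

definition ess_inf :: "'a measure \<Rightarrow> ('a \<Rightarrow> real) \<Rightarrow> real" where
  "ess_inf M A = Sup {x. \<P>(\<omega> in M. A \<omega> < x) = 0}"

definition phi :: "real \<Rightarrow> (real \<Rightarrow> ennreal) \<Rightarrow> real \<Rightarrow> ennreal" where
  "phi \<rho> g l = (INF y\<in>{0<..}. g y + ennreal (l / y powr \<rho>))"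

definition lambda_star :: "real \<Rightarrow> (real \<Rightarrow> ennreal) \<Rightarrow> ennreal" where
  "lambda_star \<rho> g = (INF y\<in>{1<..}. ennreal (y powr \<rho> / (y powr \<rho> - 1)) * g y)"

text \<open>The power \<open>x\<^sup>p\<close> of an extended nonnegative number, for exponents \<open>p > 0\<close> only.\<close>

definition ennreal_powr :: "ennreal \<Rightarrow> real \<Rightarrow> ennreal" where
  "ennreal_powr x p = (if x = \<infinity> then \<infinity> else ennreal (enn2real x powr p))"

end

theory Submission
  imports Defs "HOL-Real_Asymp.Real_Asymp"
begin

text \<open>
  Both formulas follow from the explicit form of \<open>g\<close>: for \<open>y > 0\<close>,
  \<open>g y = \<gamma> (1 - a y)\<^sup>-\<^sup>\<rho>\<close> if \<open>a y < 1\<close>, and \<open>g y = \<infinity>\<close> otherwise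
  (\<open>local_dependence_measure_eq\<close>).

  Since \<open>A \<ge> a\<close> almost surely, the event \<open>\<epsilon> A y + B < \<epsilon>\<close> forces \<open>B < \<epsilon> (1 - a y)\<close>.
  This bounds \<open>g y\<close> from below, because regular variation turns the scaling of the argument by
  \<open>c\<close> into the factor \<open>c\<^sup>-\<^sup>\<rho>\<close> (\<open>IED_scale\<close>); for \<open>a y \<ge> 1\<close> the event is null.
  Conversely, for \<open>b > a\<close> the event contains \<open>A \<le> b\<close>, \<open>B \<le> c \<epsilon>\<close> whenever \<open>b y + c < 1\<close>.
  By positive quadrant dependence this has at least the product probability, and the constant
  \<open>- log P (A \<le> b)\<close> is negligible after division by \<open>H \<epsilon>\<close>, which tends to infinity.
  Letting \<open>c\<close> increase to \<open>1 - a y\<close> gives the matching upper bound.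

  What remains is a minimisation in one real variable. Put \<open>\<alpha> = a\<^bsup>\<rho>/(1+\<rho>)\<^esup>\<close>, so that
  \<open>\<alpha>\<^bsup>1+\<rho>\<^esup> = a\<^sup>\<rho>\<close>. Jensen's inequality for \<open>x \<mapsto> x\<^bsup>1+\<rho>\<^esup>\<close> with weights
  \<open>u = 1 - a y\<close> and \<open>v = a y\<close> at the points \<open>s/u\<close> and \<open>t/v\<close>, where \<open>t = \<alpha> r\<close>
  (\<open>powr_sum_le\<close>), yields
  \<open>(s + \<alpha> r)\<^bsup>1+\<rho>\<^esup> \<le> s\<^bsup>1+\<rho>\<^esup> (1 - a y)\<^sup>-\<^sup>\<rho> + r\<^bsup>1+\<rho>\<^esup> y\<^sup>-\<^sup>\<rho>\<close>, with equality when the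
  two points agree; if \<open>a\<close>, \<open>s\<close> or \<open>r\<close> is zero, the bound is still the infimum, possibly
  reached only in a limit. With \<open>s\<^bsup>1+\<rho>\<^esup> = \<gamma>\<close> and \<open>r\<^bsup>1+\<rho>\<^esup> = l\<close> this is the formula for \<open>phi\<close>;
  with \<open>s = 1 - \<alpha>\<close> and \<open>r = 1\<close> it rearranges to the formula for \<open>lambda_star\<close>.
  If \<open>\<gamma> = \<infinity>\<close>, all quantities are infinite.
\<close>

section \<open>Regular variation\<close>

text \<open>A limit \<open>L\<close> of \<open>1 / H\<close> along the points \<open>2\<^sup>-\<^sup>n\<close> exists by monotonicity; halving the argument
  shows \<open>L = 2\<^sup>\<rho> L\<close>, hence \<open>L = 0\<close>.\<close>

lemma regularly_varying_at_0_tendsto_infinity: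
  assumes "\<rho> > 0" and H: "regularly_varying_at_0 \<rho> H"
  shows "filterlim H at_top (at_right 0)"
proof -
  have pos: "H x > 0" if "x > 0" for x
    using H that by (auto simp: regularly_varying_at_0_def)
  have anti: "H y \<le> H x" if "0 < x" "x \<le> y" for x y
    using H that by (auto simp: regularly_varying_at_0_def monotone_on_def)
  \<comment> \<open>Working with \<open>1 / H\<close> turns the possible divergence of \<open>H\<close> into convergence to \<open>0\<close>.\<close>
  define f where "f n = inverse (H (inverse 2 ^ n))" for n :: nat
  have f_pos: "f n > 0" for n by (simp add: f_def pos)
  have "decseq f"
    unfolding f_def decseq_Suc_iff
    by (intro allI le_imp_inverse_le anti pos) auto
  then obtain L where L: "f \<longlonglongrightarrow> L"
    using decseq_convergent[of f 0] f_pos less_imp_le by metis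
  have half_pow: "filterlim (\<lambda>n. inverse 2 ^ n :: real) (at_right 0) sequentially"
    by (auto simp: filterlim_at intro!: LIMSEQ_power_zero)
  have "((\<lambda>x. H (inverse 2 * x) / H x) \<longlongrightarrow> inverse 2 powr (- \<rho>)) (at_right 0)"
    using H unfolding regularly_varying_at_0_def by (metis inverse_positive_iff_positive zero_less_numeral)
  from filterlim_compose[OF this half_pow]
  have ratio: "(\<lambda>n. f n / f (Suc n)) \<longlonglongrightarrow> inverse 2 powr (- \<rho>)"
    by (simp add: f_def field_simps)
  have "(\<lambda>n. f n / f (Suc n) * f (Suc n)) \<longlonglongrightarrow> inverse 2 powr (- \<rho>) * L"
    by (intro tendsto_mult ratio LIMSEQ_Suc L)
  moreover have "(\<lambda>n. f n / f (Suc n) * f (Suc n)) = f"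
    using f_pos by (auto simp: less_le)
  ultimately have "L = inverse 2 powr (- \<rho>) * L"
    using L LIMSEQ_unique by metis
  moreover have "inverse 2 powr (- \<rho>) > (1::real)"
    using \<open>\<rho> > 0\<close> powr_less_mono2_neg[of "- \<rho>" "inverse 2" 1] by simp
  ultimately have "L = 0" by auto
  show ?thesis
    unfolding filterlim_at_top eventually_at_right_field
  proof
    fix Z :: real
    have "eventually (\<lambda>n. f n < inverse (max Z 1)) sequentially"
      using L \<open>L = 0\<close> by (intro order_tendstoD(2)[of f 0]) auto
    then obtain n where n: "f n < inverse (max Z 1)"
      by (metis eventually_happens trivial_limit_sequentially)
    have "max Z 1 < H (inverse 2 ^ n)"
      using n pos[of "inverse 2 ^ n"] unfolding f_def
      by (subst (asm) inverse_less_iff_less) auto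
    then have "Z \<le> H x" if "0 < x" "x < inverse 2 ^ n" for x
      using anti[of x "inverse 2 ^ n"] that by simp
    then show "\<exists>b>0. \<forall>y>0. y < b \<longrightarrow> Z \<le> H y"
      by (intro exI[of _ "inverse 2 ^ n"]) auto
  qed
qed

section \<open>Essential infimum and lower orthants\<close>

context prob_space
begin

text \<open>The set whose supremum is taken is bounded above because \<open>A\<close> is finite everywhere, and it
  contains \<open>0\<close>; the supremum itself is attained because an almost sure bound survives a
  countable limit.\<close>

lemma ess_inf_props:
  assumes A[measurable]: "A \<in> borel_measurable M" and nonneg: "AE \<omega> in M. A \<omega> \<ge> 0"
  shows "ess_inf M A \<ge> 0"
    and "AE \<omega> in M. ess_inf M A \<le> A \<omega>"
    and "ess_inf M A < b \<Longrightarrow> prob {\<omega> \<in> space M. A \<omega> < b} > 0"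
proof -
  define S where "S = {x. prob {\<omega> \<in> space M. A \<omega> < x} = 0}"
  have S_iff: "x \<in> S \<longleftrightarrow> (AE \<omega> in M. x \<le> A \<omega>)" for x
    unfolding S_def mem_Collect_eq
    by (subst prob_Collect_eq_0) (auto simp: not_less)
  have S0: "0 \<in> S" using nonneg by (simp add: S_iff)
  have S_bdd: "bdd_above S"
  proof (rule ccontr)
    assume "\<not> bdd_above S"
    then have unbounded: "\<exists>x\<in>S. real n < x" for n
      unfolding bdd_above_def by (meson not_le)
    have "AE \<omega> in M. real n \<le> A \<omega>" for n
    proof -
      obtain x where "x \<in> S" and x: "real n < x"
        using unbounded by blast
      then have "AE \<omega> in M. x \<le> A \<omega>" by (simp add: S_iff)
      then show ?thesis by eventually_elim (use x in linarith)
    qed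
    then have "AE \<omega> in M. \<forall>n. real n \<le> A \<omega>"
      by (simp add: AE_all_countable)
    then have "AE \<omega> in M. False"
      by eventually_elim (metis linorder_not_le reals_Archimedean2)
    then show False by simp
  qed
  have E: "ess_inf M A = Sup S" by (simp add: ess_inf_def S_def)
  show "ess_inf M A \<ge> 0"
    unfolding E by (rule cSup_upper[OF S0 S_bdd])
  have "AE \<omega> in M. Sup S - inverse (real (Suc n)) \<le> A \<omega>" for n
  proof -
    have "\<exists>x\<in>S. Sup S - inverse (real (Suc n)) < x"
    proof (rule less_cSupD)
      show "S \<noteq> {}" using S0 by blast
    qed (simp del: of_nat_Suc)
    then obtain x where "x \<in> S" and x: "Sup S - inverse (real (Suc n)) < x" by blast
    then have "AE \<omega> in M. x \<le> A \<omega>" by (simp add: S_iff)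
    then show ?thesis by eventually_elim (use x in linarith)
  qed
  then have "AE \<omega> in M. \<forall>n. Sup S - inverse (real (Suc n)) \<le> A \<omega>"
    unfolding AE_all_countable by blast
  then show "AE \<omega> in M. ess_inf M A \<le> A \<omega>"
    unfolding E
  proof eventually_elim
    case (elim \<omega>)
    have "(\<lambda>n. Sup S - inverse (real (Suc n))) \<longlonglongrightarrow> Sup S - 0"
      by (intro tendsto_intros LIMSEQ_inverse_real_of_nat)
    from LIMSEQ_le_const2[OF this] show ?case using elim by auto
  qed
  assume "ess_inf M A < b"
  then have "b \<notin> S"
    unfolding E using cSup_upper[OF _ S_bdd, of b] by auto
  then show "prob {\<omega> \<in> space M. A \<omega> < b} > 0"
    by (simp add: S_def measure_nonneg less_le)
qed

text \<open>With \<open>p = P (A > s)\<close> and \<open>q = P (B > t)\<close>, inclusion-exclusion gives the joint lower-orthant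
  probability \<open>1 - p - q + P (A > s, B > t)\<close>, which exceeds \<open>(1 - p) (1 - q)\<close> by the same amount
  as the upper-orthant probability exceeds \<open>p q\<close>.\<close>

lemma positively_quadrant_dependent_lower:
  assumes A[measurable]: "A \<in> borel_measurable M" and B[measurable]: "B \<in> borel_measurable M"
    and dep: "positively_quadrant_dependent M A B"
  shows "\<P>(\<omega> in M. A \<omega> \<le> s) * \<P>(\<omega> in M. B \<omega> \<le> t) \<le> \<P>(\<omega> in M. A \<omega> \<le> s \<and> B \<omega> \<le> t)"
proof -
  define p where "p = \<P>(\<omega> in M. A \<omega> > s)"
  define q where "q = \<P>(\<omega> in M. B \<omega> > t)"
  define r where "r = \<P>(\<omega> in M. A \<omega> > s \<and> B \<omega> > t)"
  have margins: "\<P>(\<omega> in M. A \<omega> \<le> s) = 1 - p" "\<P>(\<omega> in M. B \<omega> \<le> t) = 1 - q"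
    unfolding p_def q_def by (subst prob_neg[symmetric]; simp add: not_less)+
  have joint: "\<P>(\<omega> in M. A \<omega> \<le> s \<and> B \<omega> \<le> t) = 1 - (p + q - r)"
  proof -
    have "\<P>(\<omega> in M. A \<omega> \<le> s \<and> B \<omega> \<le> t) = 1 - \<P>(\<omega> in M. A \<omega> > s \<or> B \<omega> > t)"
      by (subst prob_neg[symmetric]) (simp_all add: not_less)
    also have "\<P>(\<omega> in M. A \<omega> > s \<or> B \<omega> > t) =
        measure M ({\<omega> \<in> space M. A \<omega> > s} \<union> {\<omega> \<in> space M. B \<omega> > t})"
      by (rule arg_cong[where f = "measure M"]) auto
    also have "\<dots> = p + q - measure M ({\<omega> \<in> space M. A \<omega> > s} \<inter> {\<omega> \<in> space M. B \<omega> > t})"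
      unfolding p_def q_def by (subst measure_Un3) (auto simp: fmeasurable_eq_sets)
    also have "{\<omega> \<in> space M. A \<omega> > s} \<inter> {\<omega> \<in> space M. B \<omega> > t} =
        {\<omega> \<in> space M. A \<omega> > s \<and> B \<omega> > t}"
      by auto
    finally show ?thesis by (simp add: r_def)
  qed
  have "p * q \<le> r"
    using dep by (simp add: positively_quadrant_dependent_def p_def q_def r_def)
  then show ?thesis unfolding margins joint by (simp add: algebra_simps)
qed

end

section \<open>The local dependence measure\<close>

lemma neg_log_antimono:
  assumes "0 \<le> p" "p \<le> q"
  shows "neg_log q \<le> neg_log p"
  using assms by (auto simp: neg_log_def intro!: ennreal_leI)

lemma neg_log_mult:
  assumes "0 \<le> p" "p \<le> 1" "0 \<le> q" "q \<le> 1"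
  shows "neg_log (p * q) = neg_log p + neg_log q"
  using assms by (auto simp: neg_log_def ln_mult ennreal_plus[symmetric] simp del: ennreal_plus)

lemma IED_scale:
  assumes "regularly_varying_at_0 \<rho> H" and "IED M H \<gamma> B" and "c > 0"
  shows "((\<lambda>\<epsilon>. neg_log \<P>(\<omega> in M. B \<omega> < c * \<epsilon>) / ennreal (H \<epsilon>))
            \<longlongrightarrow> \<gamma> * ennreal (c powr (- \<rho>))) (at_right 0)"
proof -
  have pos: "H x > 0" if "x > 0" for x
    using assms that by (auto simp: regularly_varying_at_0_def)
  have "filterlim (\<lambda>\<epsilon>::real. c * \<epsilon>) (at_right 0) (at_right 0)"
    using \<open>c > 0\<close> unfolding filterlim_at
    by (auto intro!: tendsto_eq_intros simp: eventually_at_right_field intro: exI[of _ 1])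
  then have "((\<lambda>\<epsilon>. neg_log \<P>(\<omega> in M. B \<omega> < c * \<epsilon>) / ennreal (H (c * \<epsilon>))) \<longlongrightarrow> \<gamma>) (at_right 0)"
    using assms(2) unfolding IED_def by (rule filterlim_compose[rotated])
  moreover have "((\<lambda>\<epsilon>. ennreal (H (c * \<epsilon>) / H \<epsilon>)) \<longlongrightarrow> ennreal (c powr (- \<rho>))) (at_right 0)"
    using assms by (auto simp: regularly_varying_at_0_def)
  ultimately have "((\<lambda>\<epsilon>. neg_log \<P>(\<omega> in M. B \<omega> < c * \<epsilon>) / ennreal (H (c * \<epsilon>)) *
      ennreal (H (c * \<epsilon>) / H \<epsilon>)) \<longlongrightarrow> \<gamma> * ennreal (c powr (- \<rho>))) (at_right 0)"
    using \<open>c > 0\<close> by (intro tendsto_mult_ennreal) auto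
  moreover have "neg_log \<P>(\<omega> in M. B \<omega> < c * \<epsilon>) / ennreal (H (c * \<epsilon>)) * ennreal (H (c * \<epsilon>) / H \<epsilon>)
      = neg_log \<P>(\<omega> in M. B \<omega> < c * \<epsilon>) / ennreal (H \<epsilon>)" if "\<epsilon> > 0" for \<epsilon>
  proof -
    have h: "H \<epsilon> > 0" "H (c * \<epsilon>) > 0" using pos that \<open>c > 0\<close> by auto
    then have "ennreal (H (c * \<epsilon>) / H \<epsilon>) = ennreal (H (c * \<epsilon>)) / ennreal (H \<epsilon>)"
      by (simp add: divide_ennreal)
    moreover have "x / ennreal (H (c * \<epsilon>)) * ennreal (H (c * \<epsilon>)) = x" for x
      using h by (simp add: ennreal_divide_times)
    ultimately show ?thesis by (simp add: ennreal_times_divide)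
  qed
  then have "eventually (\<lambda>\<epsilon>. neg_log \<P>(\<omega> in M. B \<omega> < c * \<epsilon>) / ennreal (H (c * \<epsilon>)) *
      ennreal (H (c * \<epsilon>) / H \<epsilon>) = neg_log \<P>(\<omega> in M. B \<omega> < c * \<epsilon>) / ennreal (H \<epsilon>)) (at_right 0)"
    by (auto simp: eventually_at_right_field intro: exI[of _ 1])
  ultimately show ?thesis by (simp cong: tendsto_cong)
qed

context prob_space
begin

lemma local_dependence_measure_lower:
  assumes A[measurable]: "A \<in> borel_measurable M" and B[measurable]: "B \<in> borel_measurable M"
    and Apos: "AE \<omega> in M. A \<omega> \<ge> 0"
    and H: "regularly_varying_at_0 \<rho> H" and ied: "IED M H \<gamma> B"
    and g: "local_dependence_measure M H A B g"
    and y: "y > 0" "ess_inf M A * y < 1"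
  shows "\<gamma> * ennreal ((1 - ess_inf M A * y) powr (- \<rho>)) \<le> g y"
proof (rule tendsto_le)
  let ?c = "1 - ess_inf M A * y"
  show "((\<lambda>\<epsilon>. neg_log \<P>(\<omega> in M. B \<omega> < ?c * \<epsilon>) / ennreal (H \<epsilon>))
            \<longlongrightarrow> \<gamma> * ennreal (?c powr (- \<rho>))) (at_right 0)"
    using y by (intro IED_scale[OF H ied]) auto
  show "((\<lambda>\<epsilon>. neg_log \<P>(\<omega> in M. \<epsilon> * A \<omega> * y + B \<omega> < \<epsilon>) / ennreal (H \<epsilon>)) \<longlongrightarrow> g y) (at_right 0)"
    using g y by (simp add: local_dependence_measure_def)
  have "\<P>(\<omega> in M. \<epsilon> * A \<omega> * y + B \<omega> < \<epsilon>) \<le> \<P>(\<omega> in M. B \<omega> < ?c * \<epsilon>)" if "\<epsilon> > 0" for \<epsilon>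
  proof (rule finite_measure_mono_AE)
    show "AE \<omega> in M. \<omega> \<in> {\<omega> \<in> space M. \<epsilon> * A \<omega> * y + B \<omega> < \<epsilon>} \<longrightarrow> \<omega> \<in> {\<omega> \<in> space M. B \<omega> < ?c * \<epsilon>}"
      using ess_inf_props(2)[OF A Apos]
    proof eventually_elim
      case (elim \<omega>)
      have "ess_inf M A * (\<epsilon> * y) \<le> A \<omega> * (\<epsilon> * y)"
        using elim that y by (intro mult_right_mono) auto
      then show ?case by (auto simp: algebra_simps)
    qed
  qed simp
  then show "eventually (\<lambda>\<epsilon>. neg_log \<P>(\<omega> in M. B \<omega> < ?c * \<epsilon>) / ennreal (H \<epsilon>)
      \<le> neg_log \<P>(\<omega> in M. \<epsilon> * A \<omega> * y + B \<omega> < \<epsilon>) / ennreal (H \<epsilon>)) (at_right 0)"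
    by (auto simp: eventually_at_right_field
        intro!: exI[of _ 1] divide_right_mono_ennreal neg_log_antimono)
qed simp

text \<open>The slack \<open>c < 1 - a y\<close> leaves room for a level \<open>b > a\<close>, at which \<open>P (A \<le> b) > 0\<close>. At
  \<open>b = a\<close> this probability may vanish, so the sharp constant is only reached as a limit.\<close>

lemma local_dependence_measure_upper:
  assumes A[measurable]: "A \<in> borel_measurable M" and B[measurable]: "B \<in> borel_measurable M"
    and Apos: "AE \<omega> in M. A \<omega> \<ge> 0"
    and "\<rho> > 0" and H: "regularly_varying_at_0 \<rho> H" and ied: "IED M H \<gamma> B"
    and dep: "positively_quadrant_dependent M A B"
    and g: "local_dependence_measure M H A B g"
    and y: "y > 0" and c: "0 < c" "c < 1 - ess_inf M A * y"
  shows "g y \<le> \<gamma> * ennreal (c powr (- \<rho>))"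
proof -
  have Hpos: "H x > 0" if "x > 0" for x
    using H that by (auto simp: regularly_varying_at_0_def)
  have "ess_inf M A < (1 - c) / y" using c y by (simp add: field_simps)
  then obtain b where b: "ess_inf M A < b" "b < (1 - c) / y" using dense by blast
  define q where "q = \<P>(\<omega> in M. A \<omega> \<le> b)"
  have "0 < \<P>(\<omega> in M. A \<omega> < b)" by (rule ess_inf_props(3)[OF A Apos b(1)])
  also have "\<dots> \<le> q" unfolding q_def by (intro finite_measure_mono) auto
  finally have q: "q > 0" .
  have q1: "q \<le> 1" by (simp add: q_def)
  have "((\<lambda>\<epsilon>. - ln q / H \<epsilon>) \<longlongrightarrow> 0) (at_right 0)"
    using regularly_varying_at_0_tendsto_infinity[OF \<open>\<rho> > 0\<close> H]
    by (intro tendsto_divide_0[OF tendsto_const] filterlim_at_top_imp_at_infinity)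
  then have "((\<lambda>\<epsilon>. ennreal (- ln q / H \<epsilon>)) \<longlongrightarrow> 0) (at_right 0)"
    using tendsto_ennrealI ennreal_0 by metis
  moreover have "eventually (\<lambda>\<epsilon>. ennreal (- ln q / H \<epsilon>) = neg_log q / ennreal (H \<epsilon>)) (at_right 0)"
    using q q1 Hpos
    by (auto simp: eventually_at_right_field neg_log_def divide_ennreal intro!: exI[of _ 1])
  ultimately have "((\<lambda>\<epsilon>. neg_log q / ennreal (H \<epsilon>)) \<longlongrightarrow> 0) (at_right 0)"
    by (simp cong: tendsto_cong)
  from tendsto_add[OF this IED_scale[OF H ied c(1)]]
  have upper: "((\<lambda>\<epsilon>. neg_log q / ennreal (H \<epsilon>) + neg_log \<P>(\<omega> in M. B \<omega> < c * \<epsilon>) / ennreal (H \<epsilon>))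
            \<longlongrightarrow> \<gamma> * ennreal (c powr (- \<rho>))) (at_right 0)"
    by simp
  have le: "neg_log \<P>(\<omega> in M. \<epsilon> * A \<omega> * y + B \<omega> < \<epsilon>) \<le> neg_log q + neg_log \<P>(\<omega> in M. B \<omega> < c * \<epsilon>)"
    if "\<epsilon> > 0" for \<epsilon>
  proof -
    have "q * \<P>(\<omega> in M. B \<omega> < c * \<epsilon>) \<le> q * \<P>(\<omega> in M. B \<omega> \<le> c * \<epsilon>)"
      using q by (intro mult_left_mono finite_measure_mono) auto
    also have "\<dots> \<le> \<P>(\<omega> in M. A \<omega> \<le> b \<and> B \<omega> \<le> c * \<epsilon>)"
      unfolding q_def by (rule positively_quadrant_dependent_lower[OF A B dep])
    also have "\<dots> \<le> \<P>(\<omega> in M. \<epsilon> * A \<omega> * y + B \<omega> < \<epsilon>)"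
    proof (intro finite_measure_mono subsetI)
      fix \<omega> assume w: "\<omega> \<in> {\<omega> \<in> space M. A \<omega> \<le> b \<and> B \<omega> \<le> c * \<epsilon>}"
      have "A \<omega> * (\<epsilon> * y) \<le> b * (\<epsilon> * y)"
        using w that y by (intro mult_right_mono) auto
      moreover have "(b * y) * \<epsilon> < (1 - c) * \<epsilon>"
        using b y that by (intro mult_strict_right_mono) (auto simp: field_simps)
      ultimately show "\<omega> \<in> {\<omega> \<in> space M. \<epsilon> * A \<omega> * y + B \<omega> < \<epsilon>}"
        using w by (auto simp: algebra_simps)
    qed simp
    finally have "neg_log \<P>(\<omega> in M. \<epsilon> * A \<omega> * y + B \<omega> < \<epsilon>) \<le> neg_log (q * \<P>(\<omega> in M. B \<omega> < c * \<epsilon>))"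
      using q by (intro neg_log_antimono) auto
    also have "\<dots> = neg_log q + neg_log \<P>(\<omega> in M. B \<omega> < c * \<epsilon>)"
      using q q1 by (intro neg_log_mult) auto
    finally show ?thesis .
  qed
  show ?thesis
  proof (rule tendsto_le[OF _ upper])
    show "((\<lambda>\<epsilon>. neg_log \<P>(\<omega> in M. \<epsilon> * A \<omega> * y + B \<omega> < \<epsilon>) / ennreal (H \<epsilon>)) \<longlongrightarrow> g y) (at_right 0)"
      using g y by (simp add: local_dependence_measure_def)
    show "eventually (\<lambda>\<epsilon>. neg_log \<P>(\<omega> in M. \<epsilon> * A \<omega> * y + B \<omega> < \<epsilon>) / ennreal (H \<epsilon>)
        \<le> neg_log q / ennreal (H \<epsilon>) + neg_log \<P>(\<omega> in M. B \<omega> < c * \<epsilon>) / ennreal (H \<epsilon>)) (at_right 0)"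
      using le by (auto simp: eventually_at_right_field simp flip: add_divide_distrib_ennreal
          intro!: exI[of _ 1] divide_right_mono_ennreal)
  qed simp
qed

lemma local_dependence_measure_eq:
  assumes A[measurable]: "A \<in> borel_measurable M" and B[measurable]: "B \<in> borel_measurable M"
    and Apos: "AE \<omega> in M. A \<omega> \<ge> 0" and Bpos: "AE \<omega> in M. B \<omega> \<ge> 0"
    and "\<rho> > 0" and H: "regularly_varying_at_0 \<rho> H" and ied: "IED M H \<gamma> B"
    and dep: "positively_quadrant_dependent M A B"
    and g: "local_dependence_measure M H A B g"
    and y: "y > 0"
  shows "g y = (if ess_inf M A * y < 1
            then \<gamma> * ennreal ((1 - ess_inf M A * y) powr (- \<rho>)) else \<infinity>)"
proof (cases "ess_inf M A * y < 1")
  case True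
  define d where "d = 1 - ess_inf M A * y"
  have d: "d > 0" using True by (simp add: d_def)
  have "g y \<le> \<gamma> * ennreal (d powr (- \<rho>))"
  proof (rule tendsto_lowerbound)
    show "((\<lambda>c. \<gamma> * ennreal (c powr (- \<rho>))) \<longlongrightarrow> \<gamma> * ennreal (d powr (- \<rho>))) (at_left d)"
      using d by (intro tendsto_mult_ennreal tendsto_const tendsto_ennrealI tendsto_powr)
        (auto intro!: tendsto_ident_at)
    show "eventually (\<lambda>c. g y \<le> \<gamma> * ennreal (c powr (- \<rho>))) (at_left d)"
      using d local_dependence_measure_upper[OF A B Apos \<open>\<rho> > 0\<close> H ied dep g y]
      by (auto simp: eventually_at_left_field d_def intro!: exI[of _ 0])
  qed simp
  then show ?thesis
    using True local_dependence_measure_lower[OF A B Apos H ied g y]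
    by (auto simp: d_def intro: antisym)
next
  case False
  have "\<P>(\<omega> in M. \<epsilon> * A \<omega> * y + B \<omega> < \<epsilon>) = 0" if "\<epsilon> > 0" for \<epsilon>
  proof (subst prob_Collect_eq_0)
    show "AE \<omega> in M. \<not> \<epsilon> * A \<omega> * y + B \<omega> < \<epsilon>"
      using ess_inf_props(2)[OF A Apos] Bpos
    proof eventually_elim
      case (elim \<omega>)
      have "\<epsilon> * 1 \<le> \<epsilon> * (ess_inf M A * y)"
        using False that by (intro mult_left_mono) auto
      also have "\<dots> \<le> \<epsilon> * (A \<omega> * y)"
        using elim y that by (intro mult_left_mono mult_right_mono) auto
      finally show ?case using elim by (simp add: mult.assoc)
    qed
  qed simp
  then have "eventually (\<lambda>\<epsilon>. neg_log \<P>(\<omega> in M. \<epsilon> * A \<omega> * y + B \<omega> < \<epsilon>) / ennreal (H \<epsilon>) = \<infinity>) (at_right 0)"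
    by (auto simp: eventually_at_right_field neg_log_def ennreal_top_divide intro!: exI[of _ 1])
  then have "((\<lambda>\<epsilon>. neg_log \<P>(\<omega> in M. \<epsilon> * A \<omega> * y + B \<omega> < \<epsilon>) / ennreal (H \<epsilon>)) \<longlongrightarrow> \<infinity>) (at_right 0)"
    by (rule tendsto_eventually)
  moreover have "((\<lambda>\<epsilon>. neg_log \<P>(\<omega> in M. \<epsilon> * A \<omega> * y + B \<omega> < \<epsilon>) / ennreal (H \<epsilon>)) \<longlongrightarrow> g y) (at_right 0)"
    using g y by (simp add: local_dependence_measure_def)
  ultimately have "g y = \<infinity>"
    using tendsto_unique trivial_limit_at_right_real by blast
  then show ?thesis using False by simp
qed

end

section \<open>The underlying minimisation problem\<close>

text \<open>For positive \<open>s, t\<close> this is convexity, since \<open>u (s/u)\<^bsup>1+\<rho>\<^esup> = s\<^bsup>1+\<rho>\<^esup> u\<^sup>-\<^sup>\<rho>\<close>. If \<open>s\<close> or \<open>t\<close>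
  vanishes, it holds because \<open>u, v \<le> 1\<close>.\<close>

lemma powr_sum_le:
  fixes s t u v \<rho> :: real
  assumes "\<rho> > 0" "s \<ge> 0" "t \<ge> 0" "u > 0" "v > 0" "u + v = 1"
  shows "(s + t) powr (1 + \<rho>) \<le> s powr (1 + \<rho>) * u powr (- \<rho>) + t powr (1 + \<rho>) * v powr (- \<rho>)"
proof -
  have scale: "w * (x / w) powr (1 + \<rho>) = x powr (1 + \<rho>) * w powr (- \<rho>)"
    if "w > 0" "x \<ge> 0" for w x
    using that by (simp add: powr_divide powr_add powr_minus field_simps)
  have one: "x powr (1 + \<rho>) \<le> x powr (1 + \<rho>) * w powr (- \<rho>)" if "0 < w" "w \<le> 1" for x w :: real
  proof -
    have "1 \<le> w powr (- \<rho>)"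
      using powr_mono2'[of "- \<rho>" w 1] that \<open>\<rho> > 0\<close> by simp
    then show ?thesis by (simp add: mult_le_cancel_left1)
  qed
  consider "s = 0" | "t = 0" | "s > 0" "t > 0" using assms by force
  then show ?thesis
  proof cases
    case 3
    have "convex_on {0<..} (\<lambda>x::real. x powr (1 + \<rho>))"
      using assms by (intro powr_convex) auto
    have u_eq: "1 - v = u" using assms(6) by simp
    from convex_onD[OF \<open>convex_on _ _\<close>, of v "s / u" "t / v"]
    have "(u * (s / u) + v * (t / v)) powr (1 + \<rho>) \<le> u * (s / u) powr (1 + \<rho>) + v * (t / v) powr (1 + \<rho>)"
      using assms(4-6) 3 by (simp add: u_eq)
    then show ?thesis using assms by (simp add: scale)
  qed (use one[of u s] one[of v t] assms in auto)
qed

lemma powr_fraction_powr: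
  fixes a \<rho> :: real
  assumes "\<rho> > 0" "a \<ge> 0"
  shows "(a powr (\<rho> / (1 + \<rho>))) powr (1 + \<rho>) = a powr \<rho>"
proof -
  have "\<rho> / (1 + \<rho>) * (1 + \<rho>) = \<rho>" using assms by simp
  then show ?thesis by (simp only: powr_powr)
qed

lemma phi_objective_ge:
  fixes a s r y \<rho> :: real
  assumes "\<rho> > 0" "a \<ge> 0" "s \<ge> 0" "r \<ge> 0" "y > 0" "a * y < 1"
  shows "(s + a powr (\<rho> / (1 + \<rho>)) * r) powr (1 + \<rho>)
           \<le> s powr (1 + \<rho>) * (1 - a * y) powr (- \<rho>) + r powr (1 + \<rho>) / y powr \<rho>"
proof (cases "a = 0")
  case False
  then have a: "a > 0" using assms by simp
  have "(a powr (\<rho> / (1 + \<rho>)) * r) powr (1 + \<rho>) * (a * y) powr (- \<rho>) = r powr (1 + \<rho>) / y powr \<rho>"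
    using assms a by (simp add: powr_mult powr_fraction_powr powr_minus field_simps)
  then show ?thesis
    using powr_sum_le[of \<rho> s "a powr (\<rho> / (1 + \<rho>)) * r" "1 - a * y" "a * y"] assms a by simp
qed (use assms in simp)

text \<open>Equality in Jensen's inequality needs \<open>s / (1 - a y) = \<alpha> r / (a y)\<close>, that is,
  \<open>a y = \<alpha> r / (s + \<alpha> r)\<close>. This is an admissible \<open>y\<close> only if \<open>a\<close>, \<open>s\<close> and \<open>r\<close> are positive.\<close>

lemma phi_objective_at_minimiser:
  fixes a s r \<rho> :: real
  assumes "\<rho> > 0" "a > 0" "s > 0" "r > 0"
  defines "\<alpha> \<equiv> a powr (\<rho> / (1 + \<rho>))"
  defines "y \<equiv> \<alpha> * r / (a * (s + \<alpha> * r))"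
  shows "y > 0" "a * y < 1"
    and "s powr (1 + \<rho>) * (1 - a * y) powr (- \<rho>) + r powr (1 + \<rho>) / y powr \<rho>
           = (s + \<alpha> * r) powr (1 + \<rho>)"
proof -
  have \<alpha>: "\<alpha> > 0" using assms by (simp add: \<alpha>_def)
  define T where "T = s + \<alpha> * r"
  have T: "T > 0" using assms \<alpha> by (simp add: T_def add_pos_pos)
  show "y > 0" unfolding y_def using assms(1-4) \<alpha> T by (simp add: T_def)
  have ay: "a * y = \<alpha> * r / T" using assms(1-4) T by (simp add: y_def T_def)
  have u: "1 - a * y = s / T" unfolding ay using T by (simp add: field_simps T_def)
  then show "a * y < 1" using assms T by (smt (verit) divide_pos_pos)
  have "\<alpha> powr (1 + \<rho>) = a powr \<rho>"
    using assms(1,2) by (simp add: \<alpha>_def powr_fraction_powr)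
  then have a_pow: "a powr \<rho> = \<alpha> * \<alpha> powr \<rho>"
    using \<alpha> by (simp add: powr_add)
  have y_eq: "y = \<alpha> * r / T / a" unfolding ay[symmetric] using assms(2) by simp
  have "y powr \<rho> = r powr \<rho> / (\<alpha> * T powr \<rho>)"
    unfolding y_eq using assms(1-4) \<alpha> T by (simp add: powr_divide powr_mult a_pow)
  then have "r powr (1 + \<rho>) / y powr \<rho> = (\<alpha> * r) * T powr \<rho>"
    using assms(1-4) by (simp add: powr_add)
  moreover have "s powr (1 + \<rho>) * (1 - a * y) powr (- \<rho>) = s * T powr \<rho>"
    unfolding u using assms(1-4) T by (simp add: powr_divide powr_minus powr_add field_simps)
  ultimately show "s powr (1 + \<rho>) * (1 - a * y) powr (- \<rho>) + r powr (1 + \<rho>) / y powr \<rho>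
           = (s + \<alpha> * r) powr (1 + \<rho>)"
    using T by (simp add: powr_add flip: T_def distrib_right)
qed

text \<open>The infimum need not be attained. If \<open>a = 0\<close>, it is approached as \<open>y \<rightarrow> \<infinity>\<close>. If \<open>a > 0\<close> and
  just one of \<open>s, r\<close> vanishes, the minimiser degenerates to an end point of \<open>(0, 1/a)\<close>; replacing
  \<open>s, r\<close> by \<open>s + \<delta>, r + \<delta>\<close> only increases the objective and provides a minimiser whose
  value is close by continuity.\<close>

lemma phi_objective_near_infimum:
  fixes a s r z \<rho> :: real
  assumes "\<rho> > 0" "a \<ge> 0" "s \<ge> 0" "r \<ge> 0"
    and z: "(s + a powr (\<rho> / (1 + \<rho>)) * r) powr (1 + \<rho>) < z"
  shows "\<exists>y>0. a * y < 1 \<and>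
           s powr (1 + \<rho>) * (1 - a * y) powr (- \<rho>) + r powr (1 + \<rho>) / y powr \<rho> < z"
proof (cases "a = 0")
  case True
  have "((\<lambda>y. s powr (1 + \<rho>) + r powr (1 + \<rho>) / y powr \<rho>) \<longlongrightarrow> s powr (1 + \<rho>) + 0) at_top"
    using \<open>\<rho> > 0\<close> by real_asymp
  then have "eventually (\<lambda>y. s powr (1 + \<rho>) + r powr (1 + \<rho>) / y powr \<rho> < z) at_top"
    using z True assms by (intro order_tendstoD(2)) auto
  with eventually_gt_at_top[of 0]
  have "eventually (\<lambda>y. y > 0 \<and> s powr (1 + \<rho>) + r powr (1 + \<rho>) / y powr \<rho> < z) at_top"
    by eventually_elim auto
  then show ?thesis
    using True eventually_happens[of _ "at_top :: real filter"] by force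
next
  case False
  define \<alpha> where "\<alpha> = a powr (\<rho> / (1 + \<rho>))"
  have "((\<lambda>\<delta>. (s + \<delta> + \<alpha> * (r + \<delta>)) powr (1 + \<rho>)) \<longlongrightarrow> (s + 0 + \<alpha> * (r + 0)) powr (1 + \<rho>)) (at_right 0)"
    using \<open>\<rho> > 0\<close> assms
    by (intro tendsto_powr' tendsto_intros)
       (auto simp: \<alpha>_def eventually_at_right_field intro!: exI[of _ 1])
  then have "eventually (\<lambda>\<delta>. (s + \<delta> + \<alpha> * (r + \<delta>)) powr (1 + \<rho>) < z) (at_right 0)"
    using z by (intro order_tendstoD(2)) (auto simp: \<alpha>_def)
  with eventually_at_right_less[of 0]
  have "eventually (\<lambda>\<delta>. \<delta> > 0 \<and> (s + \<delta> + \<alpha> * (r + \<delta>)) powr (1 + \<rho>) < z) (at_right 0)"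
    by eventually_elim auto
  then obtain \<delta> where \<delta>: "\<delta> > 0" "(s + \<delta> + \<alpha> * (r + \<delta>)) powr (1 + \<rho>) < z"
    using eventually_happens trivial_limit_at_right_real by blast
  have pos: "\<rho> > 0" "a > 0" "s + \<delta> > 0" "r + \<delta> > 0" using assms False \<delta> by auto
  define y where "y = \<alpha> * (r + \<delta>) / (a * (s + \<delta> + \<alpha> * (r + \<delta>)))"
  note y = phi_objective_at_minimiser[OF pos, folded \<alpha>_def, folded y_def]
  have "s powr (1 + \<rho>) * (1 - a * y) powr (- \<rho>) + r powr (1 + \<rho>) / y powr \<rho> \<le>
      (s + \<delta>) powr (1 + \<rho>) * (1 - a * y) powr (- \<rho>) + (r + \<delta>) powr (1 + \<rho>) / y powr \<rho>"
    using assms \<delta> by (intro add_mono mult_right_mono divide_right_mono powr_mono2) auto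
  also have "\<dots> < z" using y(3) \<delta> by simp
  finally show ?thesis using y by blast
qed

lemma powr_fraction_less_1:
  fixes a \<rho> :: real
  assumes "\<rho> > 0" "a \<ge> 0" "a < 1"
  shows "a powr (\<rho> / (1 + \<rho>)) < 1"
  using powr_less_mono2[of "\<rho> / (1 + \<rho>)" a 1] assms by simp

text \<open>The next two facts rearrange the bound for \<open>s = 1 - \<alpha>\<close>, \<open>r = 1\<close>, where
  \<open>K = (1 - \<alpha>)\<^bsup>1+\<rho>\<^esup>\<close>, \<open>Y = y\<^sup>\<rho>\<close> and \<open>U = (1 - a y)\<^sup>-\<^sup>\<rho>\<close>.\<close>

lemma lambda_term_le:
  fixes K Y U :: real
  assumes "K > 0" "Y > 1" "1 \<le> K * U + 1 / Y"
  shows "inverse K \<le> Y / (Y - 1) * U"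
proof -
  have "1 * Y \<le> (K * U + 1 / Y) * Y"
    using assms by (intro mult_right_mono) auto
  then have "Y - 1 \<le> K * (U * Y)"
    using assms(2) by (simp add: distrib_right)
  then have "(Y - 1) / K \<le> U * Y"
    using assms(1) by (simp add: pos_divide_le_eq mult.commute)
  then have "inverse K * (Y - 1) \<le> U * Y"
    by (simp add: field_simps)
  then have "inverse K \<le> U * Y / (Y - 1)"
    using assms(2) by (simp add: pos_le_divide_eq)
  then show ?thesis by (simp add: mult.commute)
qed

lemma lambda_term_eq:
  fixes K Y U :: real
  assumes "K > 0" "Y > 1" "1 = K * U + 1 / Y"
  shows "Y / (Y - 1) * U = inverse K"
proof -
  have "1 * Y = (K * U + 1 / Y) * Y" using assms(3) by simp
  then have "K * (U * Y) = Y - 1" using assms(2) by (simp add: distrib_right)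
  then have "U * Y = (Y - 1) / K" using assms(1) by (simp add: field_simps)
  then show ?thesis using assms(2) by (simp add: mult.commute[of Y] inverse_eq_divide)
qed

lemma lambda_objective_ge:
  fixes a y \<rho> :: real
  assumes "\<rho> > 0" "a \<ge> 0" "a < 1" "y > 1" "a * y < 1"
  shows "(1 - a powr (\<rho> / (1 + \<rho>))) powr (- (1 + \<rho>))
           \<le> y powr \<rho> / (y powr \<rho> - 1) * (1 - a * y) powr (- \<rho>)"
proof -
  define \<alpha> where "\<alpha> = a powr (\<rho> / (1 + \<rho>))"
  have \<alpha>: "\<alpha> < 1" unfolding \<alpha>_def using assms by (simp add: powr_fraction_less_1)
  have Y: "y powr \<rho> > 1" using assms by simp
  have "1 \<le> (1 - \<alpha>) powr (1 + \<rho>) * (1 - a * y) powr (- \<rho>) + 1 / y powr \<rho>"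
    using phi_objective_ge[of \<rho> a "1 - \<alpha>" 1 y] assms \<alpha> by (simp add: \<alpha>_def)
  then show ?thesis
    using lambda_term_le[of "(1 - \<alpha>) powr (1 + \<rho>)" "y powr \<rho>" "(1 - a * y) powr (- \<rho>)"] Y \<alpha>
    unfolding \<alpha>_def[symmetric] powr_minus[of "1 - \<alpha>"] by simp
qed

text \<open>For \<open>a > 0\<close> the minimiser for \<open>s = 1 - \<alpha>\<close>, \<open>r = 1\<close> is \<open>y = \<alpha> / a = a\<^bsup>-1/(1+\<rho>)\<^esup>\<close>, which
  exceeds \<open>1\<close> exactly because \<open>a < 1\<close>. For \<open>a = 0\<close> the infimum is approached as
  \<open>y \<rightarrow> \<infinity>\<close>.\<close>

lemma lambda_objective_near_infimum:
  fixes a z \<rho> :: real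
  assumes "\<rho> > 0" "a \<ge> 0" "a < 1" and z: "(1 - a powr (\<rho> / (1 + \<rho>))) powr (- (1 + \<rho>)) < z"
  shows "\<exists>y>1. a * y < 1 \<and> y powr \<rho> / (y powr \<rho> - 1) * (1 - a * y) powr (- \<rho>) < z"
proof (cases "a = 0")
  case True
  have "((\<lambda>y. y powr \<rho> / (y powr \<rho> - 1)) \<longlongrightarrow> 1) at_top"
    using \<open>\<rho> > 0\<close> by real_asymp
  then have "eventually (\<lambda>y. y powr \<rho> / (y powr \<rho> - 1) < z) at_top"
    using z True assms by (intro order_tendstoD(2)) auto
  with eventually_gt_at_top[of 1]
  have "eventually (\<lambda>y. y > 1 \<and> y powr \<rho> / (y powr \<rho> - 1) < z) at_top"
    by eventually_elim auto
  then show ?thesis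
    using True eventually_happens[of _ "at_top :: real filter"] by force
next
  case False
  then have a: "a > 0" using assms by simp
  define \<alpha> where "\<alpha> = a powr (\<rho> / (1 + \<rho>))"
  have \<alpha>: "0 < \<alpha>" "\<alpha> < 1" unfolding \<alpha>_def using assms a by (auto simp: powr_fraction_less_1)
  define y where "y = \<alpha> / a"
  have pos: "\<rho> > 0" "a > 0" "1 - \<alpha> > 0" "(1::real) > 0" using a assms \<alpha> by auto
  have y_eq: "\<alpha> * 1 / (a * (1 - \<alpha> + \<alpha> * 1)) = y" by (simp add: y_def)
  note y = phi_objective_at_minimiser[OF pos, folded \<alpha>_def, unfolded y_eq]
  have "a powr 1 < \<alpha>"
    unfolding \<alpha>_def using a assms by (intro powr_less_mono') auto
  then have y1: "y > 1" using a by (simp add: y_def)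
  then have Y: "y powr \<rho> > 1" using assms by simp
  have "1 = (1 - \<alpha>) powr (1 + \<rho>) * (1 - a * y) powr (- \<rho>) + 1 / y powr \<rho>"
    using y(3) by simp
  then have "y powr \<rho> / (y powr \<rho> - 1) * (1 - a * y) powr (- \<rho>) = (1 - \<alpha>) powr (- (1 + \<rho>))"
    using lambda_term_eq[of "(1 - \<alpha>) powr (1 + \<rho>)" "y powr \<rho>" "(1 - a * y) powr (- \<rho>)"] Y \<alpha>
    unfolding powr_minus[of "1 - \<alpha>"] by simp
  then show ?thesis using y1 y(2) z by (metis \<alpha>_def)
qed

section \<open>The two variational formulas\<close>

lemma le_ennreal_of_right_limit:
  assumes "\<And>z::real. K < z \<Longrightarrow> x \<le> ennreal z"
  shows "x \<le> ennreal K"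
proof (rule tendsto_lowerbound)
  show "((\<lambda>z. ennreal z) \<longlongrightarrow> ennreal K) (at_right K)"
    by (intro tendsto_ennrealI tendsto_ident_at)
  show "eventually (\<lambda>z. x \<le> ennreal z) (at_right K)"
    using assms by (auto simp: eventually_at_right_field intro!: exI[of _ "K + 1"])
qed simp

lemma phi_eq:
  fixes g :: "real \<Rightarrow> ennreal"
  assumes "\<rho> > 0" "a \<ge> 0" "l \<ge> 0"
    and g: "\<And>y. y > 0 \<Longrightarrow> g y = (if a * y < 1 then \<gamma> * ennreal ((1 - a * y) powr (- \<rho>)) else \<infinity>)"
  shows "phi \<rho> g l = ennreal_powr (ennreal_powr \<gamma> (1 / (1 + \<rho>))
                + ennreal (a powr (\<rho> / (1 + \<rho>)) * l powr (1 / (1 + \<rho>)))) (1 + \<rho>)"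
proof (cases "\<gamma> = \<infinity>")
  case True
  then have "g y = \<infinity>" if "y > 0" for y
    using that by (auto simp: g ennreal_top_mult)
  then have "phi \<rho> g l = \<infinity>"
    by (simp add: phi_def)
  then show ?thesis using True by (simp add: ennreal_powr_def)
next
  case False
  then obtain c where c: "\<gamma> = ennreal c" "c \<ge> 0" by (cases \<gamma>) auto
  define s where "s = c powr (1 / (1 + \<rho>))"
  define r where "r = l powr (1 / (1 + \<rho>))"
  have sr: "s \<ge> 0" "r \<ge> 0" by (auto simp: s_def r_def)
  have s_pow: "s powr (1 + \<rho>) = c" and r_pow: "r powr (1 + \<rho>) = l"
    using assms c by (auto simp: s_def r_def powr_powr)
  define V where "V = (s + a powr (\<rho> / (1 + \<rho>)) * r) powr (1 + \<rho>)"
  have fin: "g y + ennreal (l / y powr \<rho>) =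
      ennreal (s powr (1 + \<rho>) * (1 - a * y) powr (- \<rho>) + r powr (1 + \<rho>) / y powr \<rho>)"
    if "y > 0" "a * y < 1" for y
    using that c assms by (simp add: g s_pow r_pow ennreal_mult ennreal_plus)
  have "phi \<rho> g l = ennreal V"
  proof (rule antisym)
    show "ennreal V \<le> phi \<rho> g l"
      unfolding phi_def
    proof (rule INF_greatest)
      fix y :: real assume "y \<in> {0<..}"
      then show "ennreal V \<le> g y + ennreal (l / y powr \<rho>)"
        using fin[of y] phi_objective_ge[OF assms(1,2) sr, of y] g[of y]
        by (cases "a * y < 1") (auto simp: V_def simp del: ennreal_plus intro!: ennreal_leI)
    qed
    show "phi \<rho> g l \<le> ennreal V"
    proof (rule le_ennreal_of_right_limit)
      fix z assume "V < z"
      then obtain y where y: "y > 0" "a * y < 1"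
        "s powr (1 + \<rho>) * (1 - a * y) powr (- \<rho>) + r powr (1 + \<rho>) / y powr \<rho> < z"
        using phi_objective_near_infimum[OF assms(1,2) sr, of z] unfolding V_def by blast
      have "phi \<rho> g l \<le> g y + ennreal (l / y powr \<rho>)"
        unfolding phi_def using y by (intro INF_lower) auto
      also have "\<dots> \<le> ennreal z"
        unfolding fin[OF y(1,2)] using y(3) by (intro ennreal_leI) simp
      finally show "phi \<rho> g l \<le> ennreal z" .
    qed
  qed
  moreover have "ennreal_powr \<gamma> (1 / (1 + \<rho>)) = ennreal s"
    using c by (simp add: ennreal_powr_def s_def)
  moreover have "ennreal_powr (ennreal s + ennreal (a powr (\<rho> / (1 + \<rho>)) * r)) (1 + \<rho>) = ennreal V"
    using sr by (simp add: ennreal_powr_def V_def flip: ennreal_plus)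
  ultimately show ?thesis by (simp add: r_def)
qed

lemma lambda_star_eq:
  fixes g :: "real \<Rightarrow> ennreal"
  assumes "\<rho> > 0" "a \<ge> 0"
    and g: "\<And>y. y > 0 \<Longrightarrow> g y = (if a * y < 1 then \<gamma> * ennreal ((1 - a * y) powr (- \<rho>)) else \<infinity>)"
  shows "lambda_star \<rho> g =
            (if a < 1 then \<gamma> * ennreal ((1 - a powr (\<rho> / (1 + \<rho>))) powr (- (1 + \<rho>))) else \<infinity>)"
proof -
  define k where "k y = y powr \<rho> / (y powr \<rho> - 1)" for y
  have Y: "y powr \<rho> > 1" if "y > 1" for y using that assms by simp
  have k: "k y > 0" if "y > 1" for y unfolding k_def using Y[OF that]
    by (intro divide_pos_pos) linarith+
  have inf_k: "ennreal (k y) * g y = \<infinity>" if "y > 1" "g y = \<infinity>" for y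
    using that k[of y] by (simp add: ennreal_mult_top)
  have star: "lambda_star \<rho> g = (INF y\<in>{1<..}. ennreal (k y) * g y)"
    by (simp add: lambda_star_def k_def)
  have top: "lambda_star \<rho> g = \<infinity>" if "\<And>y. y > 1 \<Longrightarrow> g y = \<infinity>"
    unfolding star using that inf_k by simp
  show ?thesis
  proof (cases "a < 1")
    case False
    then have "\<not> a * y < 1" if "y > 1" for y
      using mult_mono[of 1 a 1 y] that by simp
    then show ?thesis using False top g by simp
  next
    case True
    define K where "K = (1 - a powr (\<rho> / (1 + \<rho>))) powr (- (1 + \<rho>))"
    have "a powr (\<rho> / (1 + \<rho>)) < 1" using True assms by (simp add: powr_fraction_less_1)
    then have "(1 - a powr (\<rho> / (1 + \<rho>))) powr x > 0" for x by simp
    then have K: "K > 0" by (simp only: K_def)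
    show ?thesis
    proof (cases "\<gamma> = \<infinity>")
      case \<gamma>: True
      have "g y = \<infinity>" if "y > 1" for y
        using that \<gamma> by (auto simp: g ennreal_top_mult)
      then show ?thesis unfolding K_def[symmetric] using top \<gamma> True K by (simp add: ennreal_top_mult)
    next
      case False
      then obtain c where c: "\<gamma> = ennreal c" "c \<ge> 0" by (cases \<gamma>) auto
      have fin: "ennreal (k y) * g y = ennreal (c * (k y * (1 - a * y) powr (- \<rho>)))"
        if "y > 1" "a * y < 1" for y
        using that c k[of y] by (simp add: g ac_simps flip: ennreal_mult)
      have "lambda_star \<rho> g = ennreal (c * K)"
      proof (rule antisym)
        show "ennreal (c * K) \<le> lambda_star \<rho> g"
          unfolding star
        proof (rule INF_greatest)
          fix y :: real assume "y \<in> {1<..}"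
          then have y: "y > 1" by simp
          show "ennreal (c * K) \<le> ennreal (k y) * g y"
          proof (cases "a * y < 1")
            case ay: True
            show ?thesis
              unfolding fin[OF y ay] unfolding K_def k_def
              using lambda_objective_ge[OF assms(1,2) True y ay] c
              by (intro ennreal_leI mult_left_mono)
          qed (use g[of y] inf_k[of y] y in simp)
        qed
        show "lambda_star \<rho> g \<le> ennreal (c * K)"
        proof (rule tendsto_lowerbound)
          show "((\<lambda>z. ennreal (c * z)) \<longlongrightarrow> ennreal (c * K)) (at_right K)"
            by (intro tendsto_ennrealI tendsto_mult tendsto_const tendsto_ident_at)
          have "lambda_star \<rho> g \<le> ennreal (c * z)" if z: "K < z" for z
          proof -
            obtain y where y: "y > 1" "a * y < 1" "k y * (1 - a * y) powr (- \<rho>) < z"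
              using lambda_objective_near_infimum[OF assms(1,2) True z[unfolded K_def]]
              unfolding k_def by blast
            have "lambda_star \<rho> g \<le> ennreal (k y) * g y"
              unfolding star using y by (intro INF_lower) auto
            also have "\<dots> \<le> ennreal (c * z)"
              unfolding fin[OF y(1,2)] using y(3) c by (intro ennreal_leI mult_left_mono) auto
            finally show ?thesis .
          qed
          then show "eventually (\<lambda>z. lambda_star \<rho> g \<le> ennreal (c * z)) (at_right K)"
            by (auto simp: eventually_at_right_field intro!: exI[of _ "K + 1"])
        qed simp
      qed
      then show ?thesis unfolding K_def[symmetric] using True c K by (simp add: ennreal_mult)
    qed
  qed
qed

theorem proposition5p4:
  fixes M :: "'a measure" and A B :: "'a \<Rightarrow> real" and H :: "real \<Rightarrow> real"
    and \<rho> a :: real and \<gamma> :: ennreal and g :: "real \<Rightarrow> ennreal"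
  assumes "prob_space M"
    and "\<rho> > 0"
    and "regularly_varying_at_0 \<rho> H"
    and "A \<in> borel_measurable M" and "AE \<omega> in M. A \<omega> \<ge> 0"
    and "B \<in> borel_measurable M" and "AE \<omega> in M. B \<omega> \<ge> 0"
    and "IED M H \<gamma> B"
    and "positively_quadrant_dependent M A B"
    and "a = ess_inf M A"
    and "local_dependence_measure M H A B g"
  shows "(\<forall>l\<ge>0. phi \<rho> g l =
            ennreal_powr (ennreal_powr \<gamma> (1 / (1 + \<rho>))
                + ennreal (a powr (\<rho> / (1 + \<rho>)) * l powr (1 / (1 + \<rho>)))) (1 + \<rho>)) \<and>
         lambda_star \<rho> g =
            (if a < 1 then \<gamma> * ennreal ((1 - a powr (\<rho> / (1 + \<rho>))) powr (- (1 + \<rho>))) else \<infinity>)"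
proof -
  interpret prob_space M by fact
  have a: "a \<ge> 0"
    using ess_inf_props(1)[OF assms(4,5)] assms(10) by simp
  have g: "g y = (if a * y < 1 then \<gamma> * ennreal ((1 - a * y) powr (- \<rho>)) else \<infinity>)" if "y > 0" for y
    unfolding \<open>a = ess_inf M A\<close>
    by (rule local_dependence_measure_eq[OF assms(4,6,5,7,2,3,8,9,11) that])
  show ?thesis
    using phi_eq[OF assms(2) a _ g] lambda_star_eq[OF assms(2) a g] by blast
qed

end
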